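(* Let $c>1$ be a fixed real number. Then the following assertion is false: for every integer $K\geq 8$ and all real numbers $x_1,\ldots,x_K$ such that $|x_n|\geq 1$ for all $n\leq K$ and $$Q:=\prod_{\varepsilon\in\{-1,1\}^K}\bigg(\sum_{n\leq K}\varepsilon_nx_n\bigg)\in\mathbb{Z}\setminus\{0\},$$ one has $$\bigg|\sum_{n\leq K}x_n\bigg|\geq e^{c(2^{K-1}-1)/K}\bigg(\frac{1}{1-2^{1-K}}\sum_{n\leq K}x_n^2\bigg)^{-(2^{K-1}-1)/2}.$$
   Context: Here $\varepsilon=(\varepsilon_1,\ldots,\varepsilon_K)$ runs over all sign vectors in $\{-1,1\}^K$, and the index $n$ ranges over the integers $1\leq n\leq K$. *)

theory Defs
  imports "HOL-Analysis.Analysis"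
begin

(* The extensional function space counts each sign vector exactly once. *)
definition sign_vectors :: "nat \<Rightarrow> (nat \<Rightarrow> real) set" where
  "sign_vectors K = {1..K} \<rightarrow>\<^sub>E {-1, 1}"

definition signed_sum_product :: "nat \<Rightarrow> (nat \<Rightarrow> real) \<Rightarrow> real" where
  "signed_sum_product K x = (\<Prod>\<epsilon>\<in>sign_vectors K. \<Sum>n=1..K. \<epsilon> n * x n)"

end

theory Submission
  imports Defs "HOL-Real_Asymp.Real_Asymp"
begin

text \<open>
  The counterexamples have one large entry: for \<open>K = M + 1\<close> take \<open>M\<close> entries \<open>-1\<close> and a last
  entry \<open>y\<close> slightly above \<open>M\<close>. Up to sign every signed sum is then \<open>y\<close> minus a sum of \<open>M\<close> signs,
  and such a sum \<open>m\<close> has size about \<open>sqrt M\<close>, so nearly all signed sums have almost the same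
  modulus. This is the near-equality case of the inequality between arithmetic and geometric means
  that gives the bound without the exponential factor.

  In detail, pairing \<open>\<epsilon>\<close> with the vector that differs in the last sign gives
  \<open>Q = (\<Prod>\<eta>. y\<^sup>2 - m\<^sub>\<eta>\<^sup>2)\<close>, the product being over sign vectors \<open>\<eta>\<close> of length \<open>M\<close>
  (\<open>signed_sum_product_spike\<close>). It vanishes at \<open>y = M\<close> and is at least 1 at \<open>y = M + 1\<close>, so some
  \<open>y\<close> in between makes \<open>Q = 1\<close> (\<open>spike_height_exists\<close>). Isolating the two constant \<open>\<eta>\<close>, whose
  factors contain \<open>\<delta> = y - M = (\<Sum>n. x n)\<close>, the equation \<open>ln Q = 0\<close> expresses \<open>ln \<delta>\<close> through
  \<open>ln y\<close> and the sum of \<open>ln (1 - m\<^sub>\<eta>\<^sup>2/y\<^sup>2)\<close> over the remaining \<open>\<eta>\<close>. By the second and fourth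
  moments of \<open>m\<close> that sum is at least \<open>- 2 ^ M * (1/M + O(ln M / M\<^sup>2))\<close>, whence
  \<open>ln \<delta> \<le> - N * ln y + N * (1/(2*M) + o(1/M))\<close> with \<open>N = 2 ^ M - 1\<close>
  (\<open>spike_gap_upper_bound\<close>). On the other side, the quadratic mean contributes
  \<open>- (N/2) * ln (M + y\<^sup>2) \<ge> - N * ln y - N/(2*M)\<close>. The two losses of \<open>N/(2*M)\<close> add up to \<open>N/M\<close>,
  which is less than \<open>c * N/(M + 1)\<close> for large \<open>M\<close> because \<open>c > 1\<close>.
\<close>

section \<open>Sums over sign vectors\<close>

lemma finite_sign_vectors [simp]: "finite (sign_vectors K)"
  by (simp add: sign_vectors_def finite_PiE)

lemma card_sign_vectors: "card (sign_vectors K) = 2 ^ K"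
  by (simp add: sign_vectors_def card_PiE numeral_2_eq_2)

lemma sign_vectors_Suc:
  "bij_betw (\<lambda>(s, \<eta>). \<eta>(Suc M := s)) ({-1, 1} \<times> sign_vectors M) (sign_vectors (Suc M))"
proof -
  have *: "{1..Suc M} = insert (Suc M) {1..M}" by auto
  have "inj_on (\<lambda>(s, \<eta>). \<eta>(Suc M := s)) ({-1, 1::real} \<times> ({1..M} \<rightarrow>\<^sub>E {-1, 1}))"
    using inj_combinator[of "Suc M" "{1..M}" "\<lambda>_. {-1, 1::real}"] by simp
  then show ?thesis
    unfolding bij_betw_def sign_vectors_def * PiE_insert_eq by simp
qed

lemma sum_fun_upd_Suc:
  "(\<Sum>n=1..Suc M. (\<eta>(Suc M := s)) n * x n) = (\<Sum>n=1..M. \<eta> n * x n) + s * (x (Suc M) :: real)"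
proof -
  have "(\<Sum>n=1..M. (\<eta>(Suc M := s)) n * x n) = (\<Sum>n=1..M. \<eta> n * x n)"
    by (intro sum.cong) auto
  then show ?thesis by simp
qed

lemma sum_sign_vectors_Suc:
  "(\<Sum>\<epsilon>\<in>sign_vectors (Suc M). f (\<Sum>n=1..Suc M. \<epsilon> n * x n)) =
   (\<Sum>\<eta>\<in>sign_vectors M. f ((\<Sum>n=1..M. \<eta> n * x n) - x (Suc M)) +
                          f ((\<Sum>n=1..M. \<eta> n * x n) + x (Suc M)))"
  (is "?L = ?R")
proof -
  have "?L = (\<Sum>(s, \<eta>)\<in>{-1, 1} \<times> sign_vectors M.
      f (\<Sum>n=1..Suc M. (\<eta>(Suc M := s)) n * x n))"
    by (subst sum.reindex_bij_betw[OF sign_vectors_Suc, symmetric])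
       (simp only: case_prod_unfold)
  also have "\<dots> = ?R"
    unfolding sum_fun_upd_Suc by (subst sum.cartesian_product[symmetric]) (simp add: sum.distrib)
  finally show ?thesis .
qed

lemma prod_sign_vectors_Suc:
  "(\<Prod>\<epsilon>\<in>sign_vectors (Suc M). f (\<Sum>n=1..Suc M. \<epsilon> n * x n)) =
   (\<Prod>\<eta>\<in>sign_vectors M. f ((\<Sum>n=1..M. \<eta> n * x n) - x (Suc M)) *
                          f ((\<Sum>n=1..M. \<eta> n * x n) + x (Suc M)))"
  (is "?L = ?R")
proof -
  have "?L = (\<Prod>(s, \<eta>)\<in>{-1, 1} \<times> sign_vectors M.
      f (\<Sum>n=1..Suc M. (\<eta>(Suc M := s)) n * x n))"
    by (subst prod.reindex_bij_betw[OF sign_vectors_Suc, symmetric])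
       (simp only: case_prod_unfold)
  also have "\<dots> = ?R"
    unfolding sum_fun_upd_Suc by (subst prod.cartesian_product[symmetric]) (simp add: prod.distrib)
  finally show ?thesis .
qed

lemma sign_sum_second_moment: "(\<Sum>\<eta>\<in>sign_vectors M. (\<Sum>n=1..M. \<eta> n)\<^sup>2) = 2 ^ M * real M"
proof (induction M)
  case 0
  then show ?case by simp
next
  case (Suc M)
  have eq: "(t - 1)\<^sup>2 + (t + 1)\<^sup>2 = 2 * t\<^sup>2 + (2::real)" for t
    by (simp add: power2_eq_square algebra_simps)
  have "(\<Sum>\<epsilon>\<in>sign_vectors (Suc M). (\<Sum>n=1..Suc M. \<epsilon> n)\<^sup>2) =
      (\<Sum>\<eta>\<in>sign_vectors M. 2 * (\<Sum>n=1..M. \<eta> n)\<^sup>2 + 2)"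
    using sum_sign_vectors_Suc[of "\<lambda>t. t\<^sup>2" "\<lambda>_. 1" M] unfolding mult_1_right eq .
  then show ?case
    unfolding sum.distrib sum_distrib_left[symmetric] Suc.IH
    by (simp add: card_sign_vectors algebra_simps)
qed

lemma sign_sum_fourth_moment:
  "(\<Sum>\<eta>\<in>sign_vectors M. (\<Sum>n=1..M. \<eta> n) ^ 4) = 2 ^ M * (3 * (real M)\<^sup>2 - 2 * real M)"
proof (induction M)
  case 0
  then show ?case by simp
next
  case (Suc M)
  have eq: "(t - 1) ^ 4 + (t + 1) ^ 4 = 2 * t ^ 4 + 12 * t\<^sup>2 + (2::real)" for t
    by (simp add: power2_eq_square power4_eq_xxxx algebra_simps)
  have "(\<Sum>\<epsilon>\<in>sign_vectors (Suc M). (\<Sum>n=1..Suc M. \<epsilon> n) ^ 4) =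
      (\<Sum>\<eta>\<in>sign_vectors M. 2 * (\<Sum>n=1..M. \<eta> n) ^ 4 + 12 * (\<Sum>n=1..M. \<eta> n)\<^sup>2 + 2)"
    using sum_sign_vectors_Suc[of "\<lambda>t. t ^ 4" "\<lambda>_. 1" M] unfolding mult_1_right eq .
  then show ?case
    unfolding sum.distrib sum_distrib_left[symmetric] Suc.IH sign_sum_second_moment
    by (simp add: card_sign_vectors algebra_simps power2_eq_square)
qed

definition constant_sign :: "nat \<Rightarrow> real \<Rightarrow> nat \<Rightarrow> real" where
  "constant_sign M s = (\<lambda>n\<in>{1..M}. s)"

abbreviation constant_signs :: "nat \<Rightarrow> (nat \<Rightarrow> real) set" where
  "constant_signs M \<equiv> {constant_sign M 1, constant_sign M (-1)}"

lemma constant_sign_in_sign_vectors: "constant_signs M \<subseteq> sign_vectors M"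
  by (auto simp: constant_sign_def sign_vectors_def)

lemma constant_sign_neq: "M \<ge> 1 \<Longrightarrow> constant_sign M 1 \<noteq> constant_sign M (-1)"
  by (auto simp: constant_sign_def fun_eq_iff restrict_def intro!: exI[of _ 1])

lemma sum_constant_sign: "(\<Sum>n=1..M. constant_sign M s n) = real M * s"
  by (simp add: constant_sign_def)

lemma abs_sign_sum_le:
  assumes "\<eta> \<in> sign_vectors M"
  shows "\<bar>\<Sum>n=1..M. \<eta> n\<bar> \<le> real M"
proof -
  have "\<bar>\<Sum>n=1..M. \<eta> n\<bar> \<le> (\<Sum>n=1..M. \<bar>\<eta> n\<bar>)" by (rule sum_abs)
  also have "\<dots> \<le> (\<Sum>n=1..M. 1)"
    proof (rule sum_mono)
    fix n assume "n \<in> {1..M}"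
    with assms have "\<eta> n \<in> {-1, 1}" unfolding sign_vectors_def by (rule PiE_mem)
    then show "\<bar>\<eta> n\<bar> \<le> 1" by auto
  qed
  finally show ?thesis by simp
qed

text \<open>One entry of each sign suffices to lose 2 compared with the trivial bound \<open>M\<close>. The loss of 1
  recorded here keeps \<open>y\<^sup>2 - m\<^sup>2\<close> away from zero.\<close>

lemma abs_sign_sum_less:
  assumes "\<eta> \<in> sign_vectors M - constant_signs M"
  shows "\<bar>\<Sum>n=1..M. \<eta> n\<bar> \<le> real M - 1"
proof -
  have \<eta>: "\<eta> n = -1 \<or> \<eta> n = 1" if "n \<in> {1..M}" for n
    using assms that by (auto simp: sign_vectors_def PiE_iff)
  have ext: "\<eta> n = undefined" if "n \<notin> {1..M}" for n
    using assms that by (auto simp: sign_vectors_def PiE_iff extensional_def)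
  have "\<exists>n\<in>{1..M}. \<eta> n \<noteq> s" if "s = 1 \<or> s = -1" for s
  proof (rule ccontr)
    assume "\<not> ?thesis"
    then have "\<eta> = constant_sign M s" using ext by (auto simp: constant_sign_def fun_eq_iff)
    with that assms show False by auto
  qed
  from this[of 1] this[of "-1"] obtain i j where
    i: "i \<in> {1..M}" "\<eta> i = -1" and j: "j \<in> {1..M}" "\<eta> j = 1"
    using \<eta> by blast
  have "(\<Sum>n=1..M. \<eta> n) = \<eta> i + (\<Sum>n\<in>{1..M}-{i}. \<eta> n)"
    using i by (intro sum.remove) auto
  moreover have "(\<Sum>n\<in>{1..M}-{i}. \<eta> n) \<le> (\<Sum>n\<in>{1..M}-{i}. 1)"
    using \<eta> by (intro sum_mono) fastforce
  moreover have "(\<Sum>n=1..M. \<eta> n) = \<eta> j + (\<Sum>n\<in>{1..M}-{j}. \<eta> n)"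
    using j by (intro sum.remove) auto
  moreover have "(\<Sum>n\<in>{1..M}-{j}. \<eta> n) \<ge> (\<Sum>n\<in>{1..M}-{j}. -1)"
    using \<eta> by (intro sum_mono) fastforce
  ultimately show ?thesis using i j by (auto simp: of_nat_diff)
qed

section \<open>The product for a vector with one large entry\<close>

definition spike :: "nat \<Rightarrow> real \<Rightarrow> nat \<Rightarrow> real" where
  "spike M y n = (if n \<le> M then -1 else y)"

lemma sum_spike: "(\<Sum>n=1..Suc M. spike M y n) = y - real M"
proof -
  have "(\<Sum>n=1..M. spike M y n) = (\<Sum>n=1..M. -1)" by (intro sum.cong) (auto simp: spike_def)
  then show ?thesis by (simp add: spike_def)
qed

lemma sum_spike_squared: "(\<Sum>n=1..Suc M. (spike M y n)\<^sup>2) = real M + y\<^sup>2"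
proof -
  have "(\<Sum>n=1..M. (spike M y n)\<^sup>2) = (\<Sum>n=1..M. 1)" by (intro sum.cong) (auto simp: spike_def)
  then show ?thesis by (simp add: spike_def)
qed

lemma signed_sum_product_spike:
  assumes "M \<ge> 1"
  shows "signed_sum_product (Suc M) (spike M y) =
    (\<Prod>\<eta>\<in>sign_vectors M. y\<^sup>2 - (\<Sum>n=1..M. \<eta> n)\<^sup>2)"
proof -
  have s: "(\<Sum>n=1..M. \<eta> n * spike M y n) = - (\<Sum>n=1..M. \<eta> n)" for \<eta> :: "nat \<Rightarrow> real"
    unfolding sum_negf[symmetric] by (intro sum.cong) (auto simp: spike_def)
  have l: "spike M y (Suc M) = y" by (simp add: spike_def)
  have p: "(- t - y) * (- t + y) = (-1) * (y\<^sup>2 - t\<^sup>2)" for t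
    by (simp add: power2_eq_square algebra_simps)
  have "signed_sum_product (Suc M) (spike M y) =
    (\<Prod>\<eta>\<in>sign_vectors M. (-1) * (y\<^sup>2 - (\<Sum>n=1..M. \<eta> n)\<^sup>2))"
    unfolding signed_sum_product_def
    using prod_sign_vectors_Suc[of "\<lambda>t. t" "spike M y" M] unfolding s l p by simp
  \<comment> \<open>The sign disappears since the number \<open>2 ^ M\<close> of factors is even.\<close>
  also have "\<dots> = (\<Prod>\<eta>\<in>sign_vectors M. y\<^sup>2 - (\<Sum>n=1..M. \<eta> n)\<^sup>2)"
    unfolding prod.distrib using assms by (simp add: card_sign_vectors)
  finally show ?thesis .
qed

lemma sign_product_split:
  assumes "M \<ge> 1"
  shows "(\<Prod>\<eta>\<in>sign_vectors M. y\<^sup>2 - (\<Sum>n=1..M. \<eta> n)\<^sup>2) =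
    (y\<^sup>2 - (real M)\<^sup>2)\<^sup>2 * (\<Prod>\<eta>\<in>sign_vectors M - constant_signs M. y\<^sup>2 - (\<Sum>n=1..M. \<eta> n)\<^sup>2)"
  by (subst prod.subset_diff[OF constant_sign_in_sign_vectors])
     (use constant_sign_neq[OF assms] in \<open>simp_all add: sum_constant_sign power2_eq_square del: One_nat_def\<close>)

lemma spike_height_exists:
  assumes "M \<ge> 1"
  obtains y where "y > real M"
    and "(\<Prod>\<eta>\<in>sign_vectors M. y\<^sup>2 - (\<Sum>n=1..M. \<eta> n)\<^sup>2) = 1"
proof -
  define Q where "Q y = (\<Prod>\<eta>\<in>sign_vectors M. y\<^sup>2 - (\<Sum>n=1..M. \<eta> n)\<^sup>2)" for y
  have Q0: "Q M = 0" unfolding Q_def sign_product_split[OF assms] by simp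
  have "Q (real M + 1) \<ge> 1"
    unfolding Q_def
  proof (rule prod_ge_1)
    fix \<eta> assume "\<eta> \<in> sign_vectors M"
    from abs_sign_sum_le[OF this] have "(\<Sum>n=1..M. \<eta> n)\<^sup>2 \<le> (real M)\<^sup>2"
      by (simp add: abs_le_square_iff[symmetric])
    then show "1 \<le> (real M + 1)\<^sup>2 - (\<Sum>n=1..M. \<eta> n)\<^sup>2"
      by (simp add: power2_sum)
  qed
  moreover have "continuous_on {real M..real M + 1} Q"
    unfolding Q_def by (intro continuous_intros)
  ultimately obtain y where y: "y \<ge> real M" "Q y = 1"
    using IVT'[of Q "real M" 1 "real M + 1"] Q0 by auto
  with Q0 have "y \<noteq> real M" by auto
  with y show ?thesis by (intro that[of y]) (auto simp: Q_def)
qed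

section \<open>Comparison of logarithms\<close>

text \<open>The logarithm is used only where \<open>s\<close> is close to 1, which is rare enough for the fourth moment
  to absorb the large factor \<open>ln M\<close>: there \<open>1 \<le> 4 * s\<^sup>2\<close>.\<close>

lemma ln_one_minus_lower:
  fixes s M :: real
  assumes "0 \<le> s" "1 / M \<le> 1 - s" "M \<ge> 1"
  shows "ln (1 - s) \<ge> - (s + (2 + 4 * ln M) * s\<^sup>2)"
proof -
  have pos: "1 - s > 0" using assms by (smt (verit) divide_pos_pos)
  have lnM: "ln M \<ge> 0" using assms by simp
  show ?thesis
  proof (cases "s \<le> 1/2")
    case True
    have "- ln (1 - s) = ln (1 / (1 - s))" using pos by (simp add: ln_div)
    also have "\<dots> \<le> 1 / (1 - s) - 1" using pos by (intro ln_le_minus_one) auto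
    also have "\<dots> \<le> s + 2 * s\<^sup>2"
    proof -
      have "0 \<le> s\<^sup>2 * (1 - 2 * s)" using True by simp
      then show ?thesis using pos by (simp add: field_simps power2_eq_square)
    qed
    also have "\<dots> \<le> s + (2 + 4 * ln M) * s\<^sup>2"
      using lnM by (simp add: algebra_simps)
    finally show ?thesis by simp
  next
    case False
    then have "(1/2)\<^sup>2 \<le> s\<^sup>2" by (intro power_mono) auto
    then have "ln M * 1 \<le> ln M * (4 * s\<^sup>2)"
      using lnM by (intro mult_left_mono) (auto simp: power2_eq_square)
    moreover have "ln (1 / M) \<le> ln (1 - s)" using assms pos by (subst ln_le_cancel_iff) auto
    then have "- ln M \<le> ln (1 - s)" using assms by (simp add: ln_div)
    ultimately show ?thesis using assms by (simp add: algebra_simps) (smt (verit) zero_le_power2)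
  qed
qed

text \<open>The two constant sign vectors contribute \<open>(y - M)\<^sup>2 * (y + M)\<^sup>2\<close> to the product, so half of
  \<open>ln Q = 0\<close> has \<open>ln (y - M)\<close> with coefficient 1. Bounding \<open>y + M\<close> below by \<open>y\<close> turns
  the \<open>2 ^ M - 2\<close> copies of \<open>ln y\<close> from the other factors into exactly the \<open>2 ^ M - 1\<close>
  copies that the quadratic mean produces, and only the moments of \<open>m / y\<close> remain.\<close>

lemma spike_gap_upper_bound:
  fixes y :: real
  assumes M: "M \<ge> 1" and y: "y > real M"
    and Q: "(\<Prod>\<eta>\<in>sign_vectors M. y\<^sup>2 - (\<Sum>n=1..M. \<eta> n)\<^sup>2) = 1"
  shows "ln (y - real M) \<le> - (2 ^ M - 1) * ln y
    + 2 ^ M / 2 * (1 / real M + (2 + 4 * ln (real M)) * (3 / (real M)\<^sup>2))"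
proof -
  define R where "R = sign_vectors M - constant_signs M"
  define s where "s \<eta> = (\<Sum>n=1..M. \<eta> n)\<^sup>2 / y\<^sup>2" for \<eta> :: "nat \<Rightarrow> real"
  define C where "C = 2 + 4 * ln (real M)"
  have C: "C \<ge> 0" using M by (simp add: C_def)
  have M0: "real M > 0" and y0: "y > 0" using M y by auto
  have finR: "finite R" by (simp add: R_def)
  have "card (constant_signs M) = 2" using constant_sign_neq[OF M] by simp
  then have cardR: "real (card R) = 2 ^ M - 2"
    using constant_sign_in_sign_vectors[of M] M
    by (simp add: R_def card_Diff_subset card_sign_vectors of_nat_diff self_le_power)
  have s1: "1 / real M \<le> 1 - s \<eta>" if "\<eta> \<in> R" for \<eta>
  proof -
    have "\<bar>\<Sum>n=1..M. \<eta> n\<bar> \<le> real M - 1" using abs_sign_sum_less that by (simp add: R_def)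
    then have sq: "(\<Sum>n=1..M. \<eta> n)\<^sup>2 \<le> (real M - 1)\<^sup>2"
      using M by (simp add: abs_le_square_iff[symmetric])
    have "s \<eta> \<le> (real M - 1)\<^sup>2 / (real M)\<^sup>2"
      unfolding s_def using M0 y by (intro frac_le sq power_mono) auto
    also have "\<dots> \<le> 1 - 1 / real M"
      using M0 M by (simp add: field_simps power2_eq_square)
    finally show ?thesis by simp
  qed
  have s2: "1 - s \<eta> > 0" if "\<eta> \<in> R" for \<eta>
    using s1[OF that] M0 by (smt (verit) divide_pos_pos)
  have fac: "y\<^sup>2 - (\<Sum>n=1..M. \<eta> n)\<^sup>2 = y\<^sup>2 * (1 - s \<eta>)" for \<eta>
    using y0 by (simp add: s_def field_simps)
  have "y\<^sup>2 - (real M)\<^sup>2 = (y - real M) * (y + real M)"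
    by (simp add: power2_eq_square algebra_simps)
  then have one: "((y - real M) * (y + real M))\<^sup>2 * (\<Prod>\<eta>\<in>R. y\<^sup>2 * (1 - s \<eta>)) = 1"
    using Q[unfolded sign_product_split[OF M] R_def[symmetric]] unfolding fac by simp
  have Ppos: "(\<Prod>\<eta>\<in>R. y\<^sup>2 * (1 - s \<eta>)) > 0"
    using y0 s2 by (intro prod_pos) simp
  have "ln (((y - real M) * (y + real M))\<^sup>2 * (\<Prod>\<eta>\<in>R. y\<^sup>2 * (1 - s \<eta>))) =
    2 * (ln (y - real M) + ln (y + real M)) + ln (\<Prod>\<eta>\<in>R. y\<^sup>2 * (1 - s \<eta>))"
    using y M0 Ppos by (subst ln_mult_pos) (auto simp: ln_realpow ln_mult_pos)
  moreover have "ln (\<Prod>\<eta>\<in>R. y\<^sup>2 * (1 - s \<eta>)) = (\<Sum>\<eta>\<in>R. 2 * ln y + ln (1 - s \<eta>))"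
  proof -
    have "ln (\<Prod>\<eta>\<in>R. y\<^sup>2 * (1 - s \<eta>)) = (\<Sum>\<eta>\<in>R. ln (y\<^sup>2 * (1 - s \<eta>)))"
      using y0 s2 finR by (intro ln_prod) (auto simp: less_imp_neq[symmetric])
    also have "\<dots> = (\<Sum>\<eta>\<in>R. 2 * ln y + ln (1 - s \<eta>))"
      using y0 s2 by (intro sum.cong) (auto simp: ln_mult_pos ln_realpow)
    finally show ?thesis .
  qed
  ultimately have main: "2 * ln (y - real M) =
      - 2 * ln (y + real M) - (2 ^ M - 2) * (2 * ln y) - (\<Sum>\<eta>\<in>R. ln (1 - s \<eta>))"
    using one by (simp add: sum.distrib cardR)
  have "- (\<Sum>\<eta>\<in>R. ln (1 - s \<eta>)) \<le> (\<Sum>\<eta>\<in>R. s \<eta> + C * (s \<eta>)\<^sup>2)"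
    unfolding sum_negf[symmetric] C_def
  proof (rule sum_mono)
    fix \<eta> assume "\<eta> \<in> R"
    then show "- ln (1 - s \<eta>) \<le> s \<eta> + (2 + 4 * ln (real M)) * (s \<eta>)\<^sup>2"
      using ln_one_minus_lower[of "s \<eta>" "real M"] s1 M by (force simp: s_def)
  qed
  also have "\<dots> \<le> (\<Sum>\<eta>\<in>sign_vectors M. s \<eta> + C * (s \<eta>)\<^sup>2)"
    using C by (intro sum_mono2) (auto simp: R_def s_def)
  also have "\<dots> = 2 ^ M * real M / y\<^sup>2 + C * (2 ^ M * (3 * (real M)\<^sup>2 - 2 * real M) / y ^ 4)"
  proof -
    have "(s \<eta>)\<^sup>2 = (\<Sum>n=1..M. \<eta> n) ^ 4 / y ^ 4" for \<eta>
      by (simp add: s_def power_divide power_mult[symmetric])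
    then show ?thesis
      by (simp add: sum.distrib sum_distrib_left[symmetric] sum_divide_distrib[symmetric]
          s_def sign_sum_second_moment sign_sum_fourth_moment del: One_nat_def)
  qed
  also have "\<dots> \<le> 2 ^ M * real M / (real M)\<^sup>2 + C * (2 ^ M * (3 * (real M)\<^sup>2) / (real M) ^ 4)"
    using y M0 C
    by (intro add_mono mult_left_mono frac_le power_mono) auto
  also have "\<dots> = 2 ^ M * (1 / real M + C * (3 / (real M)\<^sup>2))"
    using M0 by (simp add: field_simps power2_eq_square power4_eq_xxxx)
  finally have "- (\<Sum>\<eta>\<in>R. ln (1 - s \<eta>)) \<le> 2 ^ M * (1 / real M + C * (3 / (real M)\<^sup>2))" .
  moreover have "ln (y + real M) \<ge> ln y" using y0 M0 by simp
  ultimately have "ln (y - real M) \<le> - (2 ^ M - 1) * ln y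
      + 2 ^ M / 2 * E" if "E = 1 / real M + C * (3 / (real M)\<^sup>2)" for E
    using main unfolding that[symmetric] by (simp add: algebra_simps)
  then show ?thesis unfolding C_def by blast
qed

text \<open>Divided by \<open>2 ^ M\<close>, the left side is \<open>1/M + O(ln M / M\<^sup>2)\<close> and the right side is
  \<open>c/M + O(1/M\<^sup>2)\<close>. The term \<open>1/2\<close> bounds the cost of the normalising factor
  \<open>1 / (1 - 2 powr - M)\<close>.\<close>

lemma eventually_losses_less_gain:
  fixes c :: real
  assumes "c > 1"
  shows "eventually (\<lambda>M::nat.
    2 ^ M / 2 * (1 / real M + (2 + 4 * ln (real M)) * (3 / (real M)\<^sup>2)) + 1/2
      + (2 ^ M - 1) / (2 * real M) < c * (2 ^ M - 1) / (real M + 1)) at_top"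
  using assms by real_asymp

theorem mainTheorem4:
  fixes c :: real
  assumes "c > 1"
  shows "\<not> (\<forall>(K::nat) (x :: nat \<Rightarrow> real).
    K \<ge> 8 \<longrightarrow>
    (\<forall>n\<in>{1..K}. \<bar>x n\<bar> \<ge> 1) \<longrightarrow>
    signed_sum_product K x \<in> \<int> - {0} \<longrightarrow>
    \<bar>\<Sum>n=1..K. x n\<bar> \<ge>
      exp (c * (2 ^ (K - 1) - 1) / real K) *
      (1 / (1 - 2 powr (1 - real K)) * (\<Sum>n=1..K. (x n)\<^sup>2)) powr (- ((2 ^ (K - 1) - 1) / 2)))"
proof
  assume claim: "\<forall>(K::nat) (x :: nat \<Rightarrow> real).
    K \<ge> 8 \<longrightarrow>
    (\<forall>n\<in>{1..K}. \<bar>x n\<bar> \<ge> 1) \<longrightarrow>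
    signed_sum_product K x \<in> \<int> - {0} \<longrightarrow>
    \<bar>\<Sum>n=1..K. x n\<bar> \<ge>
      exp (c * (2 ^ (K - 1) - 1) / real K) *
      (1 / (1 - 2 powr (1 - real K)) * (\<Sum>n=1..K. (x n)\<^sup>2)) powr (- ((2 ^ (K - 1) - 1) / 2))"
  obtain M :: nat where M: "M \<ge> 7" and asym:
    "2 ^ M / 2 * (1 / real M + (2 + 4 * ln (real M)) * (3 / (real M)\<^sup>2)) + 1/2
      + (2 ^ M - 1) / (2 * real M) < c * (2 ^ M - 1) / (real M + 1)"
    using eventually_happens[OF eventually_conj[OF eventually_ge_at_top[of 7]
        eventually_losses_less_gain[OF assms]]] by auto
  then have M1: "M \<ge> 1" by simp
  obtain y where y: "y > real M" and Q: "(\<Prod>\<eta>\<in>sign_vectors M. y\<^sup>2 - (\<Sum>n=1..M. \<eta> n)\<^sup>2) = 1"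
    using spike_height_exists[OF M1] .
  define N :: real where "N = 2 ^ M - 1"
  have "(2::real) ^ 1 \<le> 2 ^ M" using M1 by (intro power_increasing) auto
  then have N: "N \<ge> 1" by (simp add: N_def)
  define B where "B = 1 / (1 - 2 powr (1 - real (Suc M))) * (real M + y\<^sup>2)"
  have y0: "y > 0" and M0: "real M > 0" using y M1 by auto
  have "exp (c * N / real (Suc M)) * B powr (- (N / 2)) \<le> \<bar>y - real M\<bar>"
  proof -
    have "\<forall>n\<in>{1..Suc M}. \<bar>spike M y n\<bar> \<ge> 1" using y M1 by (auto simp: spike_def)
    moreover have "signed_sum_product (Suc M) (spike M y) \<in> \<int> - {0}"
      unfolding signed_sum_product_spike[OF M1] Q by simp
    ultimately show ?thesis
      using claim[rule_format, of "Suc M" "spike M y"] M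
      unfolding sum_spike sum_spike_squared B_def N_def by simp
  qed
  then have low: "exp (c * N / real (Suc M)) * B powr (- (N / 2)) \<le> y - real M"
    using y by simp
  have "2 powr (1 - real (Suc M)) = 1 / 2 ^ M"
    by (simp add: powr_minus powr_realpow divide_simps)
  then have "1 / (1 - 2 powr (1 - real (Suc M))) = 1 / (1 - 1 / 2 ^ M)" by simp
  also have "\<dots> = 1 + 1 / N"
    using N by (simp add: N_def divide_simps)
  finally have "1 / (1 - 2 powr (1 - real (Suc M))) = 1 + 1 / N" .
  moreover have "real M + y\<^sup>2 = y\<^sup>2 * (1 + real M / y\<^sup>2)" using y0 by (simp add: field_simps)
  ultimately have B: "B = (1 + 1 / N) * (y\<^sup>2 * (1 + real M / y\<^sup>2))" by (simp add: B_def)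
  have pos: "1 + 1 / N > 0" "1 + real M / y\<^sup>2 > 0" using N y0 M0 by (auto simp: add_pos_pos)
  then have Bpos: "B > 0" using y0 by (simp add: B)
  have "ln B = ln (1 + 1 / N) + (2 * ln y + ln (1 + real M / y\<^sup>2))"
    using pos y0 by (simp add: B ln_mult_pos ln_realpow)
  also have "ln (1 + 1 / N) \<le> 1 / N" using N by (intro ln_add_one_self_le_self) auto
  also have "ln (1 + real M / y\<^sup>2) \<le> real M / y\<^sup>2" by (intro ln_add_one_self_le_self) auto
  also have "real M / y\<^sup>2 \<le> real M / (real M)\<^sup>2"
    using y M0 by (intro divide_left_mono power_mono) auto
  also have "\<dots> = 1 / real M" using M0 by (simp add: power2_eq_square)
  finally have lnB: "ln B \<le> 1 / N + (2 * ln y + 1 / real M)" by simp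
  have "N / 2 * ln B \<le> N / 2 * (1 / N + (2 * ln y + 1 / real M))"
    using lnB N by (intro mult_left_mono) auto
  also have "\<dots> = 1 / 2 + N * ln y + N / (2 * real M)" using N by (simp add: field_simps)
  finally have B_cost: "N / 2 * ln B \<le> 1 / 2 + N * ln y + N / (2 * real M)" .
  have "ln (exp (c * N / real (Suc M)) * B powr (- (N / 2))) \<le> ln (y - real M)"
    using low Bpos y by (subst ln_le_cancel_iff) auto
  then have "c * N / (real M + 1) - N / 2 * ln B \<le> ln (y - real M)"
    using Bpos by (simp add: ln_mult_pos ln_powr add.commute)
  with B_cost spike_gap_upper_bound[OF M1 y Q] asym show False
    unfolding N_def[symmetric] by (simp add: algebra_simps)
qed

end
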